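(* Let $\varepsilon > 0$ be a real number and let $d \geq 1$ be an integer. Let $K \subseteq \mathbb{R}^d$ be a convex body. If there is a volume-preserving affine transformation $f\colon \mathbb{R}^d \to \mathbb{R}^d$ such that $f(K)$ has diameter $D$, then \[p_d^K \leq\frac{ (d+2)D^d}{d!\,\lambda_d(K)}.\] In particular, if $D \leq d^{1-\varepsilon}\lambda_d(K)^{1/d}$, then $p^K_d \leq \frac{(d+2)d^{(1-\varepsilon)d}}{d!}$.
   Context: A convex body in $\mathbb{R}^d$ is a compact convex subset of $\mathbb{R}^d$ with nonempty interior (not necessarily of unit volume). $\lambda_d$ denotes the $d$-dimensional Lebesgue measure on $\mathbb{R}^d$. For a convex body $K\subseteq\mathbb{R}^d$, $p^K_d$ denotes the probability that the convex hull of $d+2$ points chosen uniformly and independently at random from $K$ is a $d$-simplex, that is, that one of the $d+2$ points falls in the convex hull of the remaining $d+1$ points. *)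

theory Defs
  imports "HOL-Probability.Probability"
begin

definition convex_body :: "'a::euclidean_space set \<Rightarrow> bool" where
  "convex_body K \<longleftrightarrow> compact K \<and> convex K \<and> interior K \<noteq> {}"

definition affine_transformation :: "('a::real_vector \<Rightarrow> 'b::real_vector) \<Rightarrow> bool" where
  "affine_transformation f \<longleftrightarrow> (\<exists>g c. linear g \<and> f = (\<lambda>x. g x + c))"

(* No separate invertibility condition on affine maps is needed: a singular affine map sends
   every set to a null set, so it is not volume-preserving. *)
definition volume_preserving :: "('a::euclidean_space \<Rightarrow> 'a) \<Rightarrow> bool" where
  "volume_preserving f \<longleftrightarrow>
     (\<forall>S\<in>sets lebesgue. f ` S \<in> sets lebesgue \<and> emeasure lebesgue (f ` S) = emeasure lebesgue S)"

(* The law of the sequence x 0, ..., x (m - 1) of m independent points that are uniformly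
   distributed in K. *)
definition uniform_points :: "nat \<Rightarrow> 'a::euclidean_space set \<Rightarrow> (nat \<Rightarrow> 'a) measure" where
  "uniform_points m K = (\<Pi>\<^sub>M i\<in>{..<m}. uniform_measure lborel K)"

(* The event below is a Borel set. It differs by a null set (all d + 2 points on one hyperplane)
   from the event that x i lies in the convex hull of the other points for some i. *)
definition simplex_prob :: "(real ^ 'n) set \<Rightarrow> real" where
  "simplex_prob K =
     measure (uniform_points (CARD('n) + 2) K)
       {x \<in> space (uniform_points (CARD('n) + 2) K).
          int CARD('n) simplex (convex hull (x ` {..<CARD('n) + 2}))}"

end

(* If the convex hull of d + 2 points is a d-simplex, its d + 1 vertices are among the points, so some
   point x i lies in the convex hull of the other d + 1. Given those, this has probability at most
   the volume of their convex hull divided by that of K. A volume-preserving affine map does not change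
   the former, and it makes all edges of the hull at most D long, so Hadamard's inequality bounds
   that volume by D^d / d!. A union bound over i gives the factor d + 2. *)
theory Submission
  imports Defs
begin

section \<open>Hadamard's inequality\<close>

text \<open>Orthogonality makes the Gram matrix \<open>A ** transpose A\<close> diagonal, with the
  squared row lengths on its diagonal.\<close>

lemma det_squared_orthogonal_rows:
  fixes A :: "real^'n^'n"
  assumes "\<And>i j. i \<noteq> j \<Longrightarrow> orthogonal (row i A) (row j A)"
  shows "(det A)\<^sup>2 = (\<Prod>i\<in>UNIV. norm (row i A))\<^sup>2"
proof -
  have entry: "(A ** transpose A) $ i $ j = row i A \<bullet> row j A" for i j
    by (simp add: matrix_matrix_mult_def transpose_def row_def inner_vec_def)
  have "(det A)\<^sup>2 = det (A ** transpose A)"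
    by (simp add: det_mul power2_eq_square)
  also have "\<dots> = (\<Prod>i\<in>UNIV. (A ** transpose A) $ i $ i)"
    using assms by (intro det_diagonal) (simp add: entry orthogonal_def)
  also have "\<dots> = (\<Prod>i\<in>UNIV. norm (row i A))\<^sup>2"
    by (simp add: entry power2_norm_eq_inner prod_power_distrib)
  finally show ?thesis .
qed

text \<open>Gram-Schmidt without normalization: subtracting from a row its projection onto the span
  of other rows keeps the determinant and lengthens nothing. Induction over a set of processed
  indices replaces an ordering of the rows.\<close>

lemma orthogonalize_rows:
  fixes A :: "real^'n^'n"
  assumes "finite S"
  shows "\<exists>B. det B = det A \<and> (\<forall>i. norm (row i B) \<le> norm (row i A)) \<and>
             (\<forall>i\<in>S. \<forall>j\<in>S. i \<noteq> j \<longrightarrow> orthogonal (row i B) (row j B))"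
  using assms
proof (induction S)
  case empty
  show ?case by (intro exI[of _ A]) auto
next
  case (insert i S)
  then obtain B where B: "det B = det A" "\<And>i. norm (row i B) \<le> norm (row i A)"
    "\<And>i j. i \<in> S \<Longrightarrow> j \<in> S \<Longrightarrow> i \<noteq> j \<Longrightarrow> orthogonal (row i B) (row j B)"
    by blast
  define R where "R = (\<lambda>j. row j B) ` S"
  obtain y z where yz: "y \<in> span R" "\<And>w. w \<in> span R \<Longrightarrow> orthogonal z w" "row i B = y + z"
    using orthogonal_subspace_decomp_exists[of R "row i B"] by metis
  \<comment> \<open>Row \<open>i\<close> becomes its orthogonal component \<open>z\<close>; the sum
    with \<open>- y\<close> is the shape in which \<open>det_row_span\<close> expects a row
    operation.\<close>
  define B' where "B' = (\<chi> k. if k = i then row i B + (- y) else row k B)"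
  have row: "row k B' = (if k = i then z else row k B)" for k
    using yz(3) by (auto simp: B'_def row_def vec_eq_iff)
  have "R \<subseteq> {row j B | j. j \<noteq> i}"
    using insert.hyps by (auto simp: R_def)
  then have "- y \<in> span {row j B | j. j \<noteq> i}"
    using yz(1) span_mono span_neg by blast
  then have "det B' = det B"
    unfolding B'_def by (intro det_row_span) (simp add: span_vec_eq)
  moreover have "norm z \<le> norm (row i B)"
  proof -
    have "orthogonal z y" using yz by blast
    then have "(norm (row i B))\<^sup>2 = (norm y)\<^sup>2 + (norm z)\<^sup>2"
      unfolding yz(3) by (intro norm_add_Pythagorean) (simp add: orthogonal_commute)
    then show ?thesis
      by (simp add: norm_le_square dot_square_norm)
  qed
  moreover have "orthogonal z (row j B)" if "j \<in> S" for j
    using yz(2) that by (simp add: R_def span_base)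
  moreover from calculation have "norm (row k B') \<le> norm (row k A)" for k
    using B(2)[of k] by (auto simp: row)
  ultimately show ?case
    using B(1,3) insert.hyps by (intro exI[of _ B']) (auto simp: row orthogonal_commute)
qed

theorem Hadamard_det_le:
  fixes A :: "real^'n^'n"
  shows "\<bar>det A\<bar> \<le> (\<Prod>i\<in>UNIV. norm (row i A))"
proof -
  obtain B where B: "det B = det A" "\<And>i. norm (row i B) \<le> norm (row i A)"
    "\<And>i j. i \<noteq> j \<Longrightarrow> orthogonal (row i B) (row j B)"
    using orthogonalize_rows[of UNIV A] by auto
  have "\<bar>det A\<bar> = (\<Prod>i\<in>UNIV. norm (row i B))"
  proof (rule power2_eq_imp_eq)
    show "\<bar>det A\<bar>\<^sup>2 = (\<Prod>i\<in>UNIV. norm (row i B))\<^sup>2"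
      using det_squared_orthogonal_rows[OF B(3)] B(1) by simp
  qed (auto intro: prod_nonneg)
  also have "\<dots> \<le> (\<Prod>i\<in>UNIV. norm (row i A))"
    by (intro prod_mono) (auto simp: B)
  finally show ?thesis .
qed

section \<open>Volume of the hull of at most d + 1 points at bounded mutual distance\<close>

text \<open>Too few points span a proper affine subspace, so their hull is null. Otherwise the
  volume is the absolute determinant of the edge vectors at one vertex divided by d!, and Hadamard's
  inequality applies.\<close>

lemma measure_convex_hull_le_wellorder:
  fixes X :: "(real ^ 'n :: {finite, wellorder}) set"
  assumes X: "finite X" "card X \<le> Suc CARD('n)" and D: "\<And>x y. x \<in> X \<Longrightarrow> y \<in> X \<Longrightarrow> dist x y \<le> D"
    and "D \<ge> 0"
  shows "measure lborel (convex hull X) \<le> D ^ CARD('n) / fact CARD('n)"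
proof (cases "card X = Suc CARD('n)")
  case False
  then have "aff_dim (convex hull X) \<noteq> DIM(real ^ 'n::_)"
    using aff_dim_le_card[OF X(1)] X(2) by (simp add: aff_dim_convex_hull)
  then have "interior (convex hull X) = {}"
    using aff_dim_nonempty_interior[of "convex hull X"] by auto
  then have "negligible (convex hull X)"
    by (simp add: negligible_convex_interior)
  then have "measure lborel (convex hull X) = 0"
    using X(1) measure_completion[of "convex hull X" lborel]
    by (simp add: negligible_iff_null_sets measure_eq_0_null_sets borel_compact finite_imp_compact_convex_hull)
  then show ?thesis
    using \<open>D \<ge> 0\<close> by simp
next
  case True
  then obtain x0 where x0: "x0 \<in> X" by fastforce
  have "card (X - {x0}) = card (UNIV :: 'n set)"
    using True x0 X by simp
  then obtain f :: "'n \<Rightarrow> real ^ 'n::_" where f: "bij_betw f UNIV (X - {x0})"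
    using X(1) by (metis finite_Diff finite_same_card_bij finite)
  \<comment> \<open>The edge vectors form the columns, as in \<open>content_simplex\<close>; the row
    version of Hadamard's inequality is therefore applied to the transpose.\<close>
  define M :: "real^'n::_^'n::_" where "M = (\<chi> i. \<chi> j. f j $ i - x0 $ i)"
  have row: "row i (transpose M) = f i - x0" for i
    by (simp add: M_def column_def vec_eq_iff)
  have "\<bar>det M\<bar> = \<bar>det (transpose M)\<bar>"
    by (simp add: det_transpose)
  also have "\<dots> \<le> (\<Prod>i\<in>UNIV. norm (row i (transpose M)))"
    by (rule Hadamard_det_le)
  also have "\<dots> \<le> (\<Prod>i\<in>(UNIV::'n set). D)"
    using x0 D bij_betwE[OF f] by (intro prod_mono) (auto simp: row simp del: row_transpose simp flip: dist_norm)
  finally have "\<bar>det M\<bar> \<le> D ^ CARD('n)" by simp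
  then show ?thesis
    using content_simplex[OF X(1) True x0 f] by (simp add: M_def divide_right_mono)
qed

text \<open>The library computes the volume of a simplex only for index types of class \<^class>\<open>wellorder\<close>.
  This type supplies such an index type of the same cardinality as a given finite type.\<close>

typedef 'n index = "{..<CARD('n::finite)}"
  by (rule exI[of _ 0]) simp

instance index :: (finite) finite
proof
  have "finite (Abs_index ` {..<CARD('a)} :: 'a index set)"
    by simp
  then show "finite (UNIV :: 'a index set)"
    by (simp only: type_definition.Abs_image[OF type_definition_index])
qed

instantiation index :: (finite) wellorder
begin

definition less_eq_index :: "'a index \<Rightarrow> 'a index \<Rightarrow> bool"
  where "x \<le> y \<longleftrightarrow> Rep_index x \<le> Rep_index y"

definition less_index :: "'a index \<Rightarrow> 'a index \<Rightarrow> bool"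
  where "x < y \<longleftrightarrow> Rep_index x < Rep_index y"

instance
proof
  fix P :: "'a index \<Rightarrow> bool" and a :: "'a index"
  assume step: "\<And>x. (\<And>y. y < x \<Longrightarrow> P y) \<Longrightarrow> P x"
  show "P a"
  proof (induction a rule: measure_induct_rule[of Rep_index])
    case (less x)
    show ?case by (rule step) (rule less.IH, simp only: less_index_def)
  qed
qed (auto simp: less_eq_index_def less_index_def Rep_index_inject)

end

lemma card_index: "CARD('n::finite index) = CARD('n)"
  by (simp add: type_definition.card[OF type_definition_index])

text \<open>Lebesgue measure is determined by its values on boxes. Relabelling pulls a box back to a
  box whose side lengths are the same up to order.\<close>

lemma lborel_distr_permute:
  fixes \<sigma> :: "'m::finite \<Rightarrow> 'n::finite"
  assumes "bij \<sigma>"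
  shows "distr lborel borel (\<lambda>x :: real^'n. \<chi> i. x $ \<sigma> i) = (lborel :: (real^'m) measure)"
proof (rule lborel_eqI[symmetric])
  define \<phi> :: "real^'n \<Rightarrow> real^'m" where "\<phi> = (\<lambda>x. \<chi> i. x $ \<sigma> i)"
  have "linear \<phi>"
    by (auto simp: \<phi>_def linear_iff vec_eq_iff)
  then have meas: "\<phi> \<in> borel_measurable borel"
    by (intro borel_measurable_continuous_onI linear_continuous_on linear_conv_bounded_linear[THEN iffD1])
  fix l u :: "real^'m"
  assume lu: "\<And>b. b \<in> Basis \<Longrightarrow> l \<bullet> b \<le> u \<bullet> b"
  have le: "l $ i \<le> u $ i" for i
    using lu[of "axis i 1"] by (simp add: axis_in_Basis_iff inner_axis)
  define \<psi> :: "real^'m \<Rightarrow> real^'n" where "\<psi> = (\<lambda>x. \<chi> i. x $ inv \<sigma> i)"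
  have [simp]: "\<sigma> (inv \<sigma> j) = j" "inv \<sigma> (\<sigma> i) = i" for i j
    using assms by (auto simp: bij_is_surj surj_f_inv_f bij_is_inj)
  have vimage: "\<phi> -` box l u = box (\<psi> l) (\<psi> u)"
  proof -
    have all_iff: "(\<forall>j. Q j) \<longleftrightarrow> (\<forall>i. Q (\<sigma> i))" for Q
      using bij_is_surj[OF assms] by (metis surjD)
    show ?thesis
      by (auto simp: set_eq_iff mem_box_cart \<phi>_def \<psi>_def all_iff[of "\<lambda>j. l $ inv \<sigma> j < _ $ j \<and> _ $ j < u $ inv \<sigma> j"])
  qed
  \<comment> \<open>The index type is left general because the formula is used for both
    \<open>'n\<close> and \<open>'m\<close>.\<close>
  have prod: "(\<Prod>b\<in>Basis. (y - x) \<bullet> b) = (\<Prod>i\<in>UNIV. y $ i - x $ i)" for x y :: "real^'k"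
    by (simp add: Basis_vec_def UNION_singleton_eq_range prod.reindex inj_on_def axis_eq_axis inner_axis)
  have "emeasure (distr lborel borel \<phi>) (box l u) = emeasure lborel (box (\<psi> l) (\<psi> u))"
    using meas by (simp add: emeasure_distr vimage)
  also have "\<dots> = (\<Prod>b\<in>Basis. (\<psi> u - \<psi> l) \<bullet> b)"
    using le by (intro emeasure_lborel_box) (auto simp: Basis_vec_def \<psi>_def inner_axis)
  also have "(\<Prod>b\<in>Basis. (\<psi> u - \<psi> l) \<bullet> b) = (\<Prod>b\<in>Basis. (u - l) \<bullet> b)"
    unfolding prod \<psi>_def using assms
    by (simp add: prod.reindex_bij_betw[of "inv \<sigma>" UNIV UNIV "\<lambda>i. u $ i - l $ i"] bij_imp_bij_inv)
  finally show "emeasure (distr lborel borel (\<lambda>x. \<chi> i. x $ \<sigma> i)) (box l u) = (\<Prod>b\<in>Basis. (u - l) \<bullet> b)"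
    by (simp add: \<phi>_def)
qed simp

text \<open>Relabelling the coordinates by \<open>'n index\<close> is a linear isometry that
  preserves volume, so the bound carries over from the well-ordered index type.\<close>

theorem measure_convex_hull_le:
  fixes X :: "(real ^ 'n) set"
  assumes X: "finite X" "card X \<le> Suc CARD('n)" and D: "\<And>x y. x \<in> X \<Longrightarrow> y \<in> X \<Longrightarrow> dist x y \<le> D"
    and "D \<ge> 0"
  shows "measure lborel (convex hull X) \<le> D ^ CARD('n) / fact CARD('n)"
proof -
  obtain \<sigma> :: "'n index \<Rightarrow> 'n" where \<sigma>: "bij \<sigma>"
    using finite_same_card_bij[of "UNIV :: 'n index set" "UNIV :: 'n set"] by (auto simp: card_index)
  define \<phi> :: "real^'n \<Rightarrow> real^'n index" where "\<phi> = (\<lambda>x. \<chi> i. x $ \<sigma> i)"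
  have "linear \<phi>"
    by (auto simp: \<phi>_def linear_iff vec_eq_iff)
  then have meas: "\<phi> \<in> borel_measurable borel"
    by (intro borel_measurable_continuous_onI linear_continuous_on linear_conv_bounded_linear[THEN iffD1])
  have "inj \<phi>"
  proof (rule injI)
    fix x y assume "\<phi> x = \<phi> y"
    then have "x $ \<sigma> i = y $ \<sigma> i" for i
      by (simp add: \<phi>_def vec_eq_iff)
    then show "x = y"
      using bij_is_surj[OF \<sigma>] by (metis surjD vec_eq_iff)
  qed
  have dist: "dist (\<phi> x) (\<phi> y) = dist x y" for x y
    using sum.reindex_bij_betw[OF \<sigma>, of "\<lambda>i. (dist (x $ i) (y $ i))\<^sup>2"]
    by (simp add: \<phi>_def dist_vec_def L2_set_def)
  have hull: "\<phi> ` (convex hull X) = convex hull (\<phi> ` X)"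
    using \<open>linear \<phi>\<close> by (rule convex_hull_linear_image)
  have "emeasure lborel (convex hull (\<phi> ` X)) = emeasure (distr lborel borel \<phi>) (convex hull (\<phi> ` X))"
    using lborel_distr_permute[OF \<sigma>] by (simp add: \<phi>_def)
  also have "\<dots> = emeasure lborel (convex hull X)"
    using meas \<open>inj \<phi>\<close> X(1) hull
    by (subst emeasure_distr)
       (simp_all add: borel_compact finite_imp_compact_convex_hull inj_vimage_image_eq flip: hull,
        simp add: hull borel_compact finite_imp_compact_convex_hull)
  finally have "measure lborel (convex hull X) = measure lborel (convex hull (\<phi> ` X))"
    by (simp add: measure_def)
  also have "\<dots> \<le> D ^ CARD('n index) / fact CARD('n index)"
    using X D \<open>D \<ge> 0\<close> card_image_le[OF X(1), of \<phi>]
    by (intro measure_convex_hull_le_wellorder) (auto simp: card_index dist)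
  finally show ?thesis
    by (simp add: card_index)
qed

section \<open>Random points: redundancy, measurability and the union bound\<close>

text \<open>The n + 1 vertices are extreme points of the hull, hence occur among the given points.
  One index for each vertex suffices, so some index is left over, and its point lies in the hull of
  the vertices.\<close>

lemma simplex_convex_hull_imp_redundant_point:
  fixes x :: "'i \<Rightarrow> 'a::euclidean_space"
  assumes "finite I" "int n simplex (convex hull (x ` I))" "Suc n < card I"
  shows "\<exists>i\<in>I. x i \<in> convex hull (x ` (I - {i}))"
proof -
  obtain C where C: "\<not> affine_dependent C" "int (card C) = int n + 1" "convex hull (x ` I) = convex hull C"
    using assms(2) by (auto simp: simplex_def)
  have "C \<subseteq> x ` I"
    using C extreme_point_of_convex_hull_affine_independent extreme_point_of_convex_hull by (metis subsetI)
  \<comment> \<open>Choosing \<open>T\<close> with \<open>x\<close> injective on it gives exactly n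
    + 1 indices even if some of the points coincide.\<close>
  then obtain T where T: "T \<subseteq> I" "C = x ` T" "inj_on x T"
    by (meson subset_image_inj)
  have "card T = Suc n"
    using C(2) T by (simp add: card_image)
  then obtain i where i: "i \<in> I" "i \<notin> T"
    using assms T(1) by (metis less_irrefl subset_antisym subsetI)
  have "x i \<in> convex hull C"
    using i by (simp flip: C(3) add: hull_inc)
  also have "convex hull C \<subseteq> convex hull (x ` (I - {i}))"
    using T i by (intro hull_mono) auto
  finally show ?thesis using i by blast
qed

text \<open>A separating functional can be perturbed into a countable dense set; this makes the event that a random
  point lies in the convex hull of others measurable.\<close>

lemma mem_convex_hull_iff_dense:
  fixes S :: "'a::euclidean_space set"
  assumes "finite S" and dense: "\<And>U. open U \<Longrightarrow> U \<noteq> {} \<Longrightarrow> \<exists>a\<in>Q. a \<in> (U :: 'a set)"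
  shows "z \<in> convex hull S \<longleftrightarrow> (\<forall>a\<in>Q. \<exists>y\<in>S. a \<bullet> y \<le> a \<bullet> z)"
proof
  assume z: "z \<in> convex hull S"
  show "\<forall>a\<in>Q. \<exists>y\<in>S. a \<bullet> y \<le> a \<bullet> z"
  proof (intro ballI, rule ccontr)
    fix a assume "\<not> (\<exists>y\<in>S. a \<bullet> y \<le> a \<bullet> z)"
    then have "convex hull S \<subseteq> {y. a \<bullet> y > a \<bullet> z}"
      by (intro hull_minimal convex_halfspace_gt) auto
    then show False using z by auto
  qed
next
  assume Q: "\<forall>a\<in>Q. \<exists>y\<in>S. a \<bullet> y \<le> a \<bullet> z"
  show "z \<in> convex hull S"
  proof (rule ccontr)
    assume "z \<notin> convex hull S"
    then obtain a b where "a \<bullet> z < b" "\<forall>y\<in>convex hull S. a \<bullet> y > b"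
      using separating_hyperplane_closed_point[of "convex hull S" z] assms(1)
      by (metis convex_convex_hull finite_imp_compact_convex_hull compact_imp_closed)
    then have a: "a \<in> (\<Inter>y\<in>S. {a. a \<bullet> z < a \<bullet> y})"
      by (force dest: hull_inc[of _ S convex])
    \<comment> \<open>Since \<open>S\<close> is finite, strict separation is a finite conjunction of
      open conditions on \<open>a\<close>.\<close>
    have "open (\<Inter>y\<in>S. {a. a \<bullet> z < a \<bullet> y})"
      using assms(1) by (intro open_INT ballI open_Collect_less continuous_intros)
    with a obtain q where "q \<in> Q" "q \<in> (\<Inter>y\<in>S. {a. a \<bullet> z < a \<bullet> y})"
      using dense by blast
    then show False using Q by force
  qed
qed

text \<open>Testing against a countable dense set turns membership into a countable intersection of
  finite unions of measurable sets.\<close>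

lemma measurable_mem_convex_hull:
  fixes M :: "'i \<Rightarrow> 'a::euclidean_space measure"
  assumes "finite J" "i \<in> I" "J \<subseteq> I" "\<And>j. j \<in> I \<Longrightarrow> sets (M j) = sets borel"
  shows "Measurable.pred (Pi\<^sub>M I M) (\<lambda>x. x i \<in> convex hull (x ` J))"
proof -
  obtain Q :: "'a set" where Q: "countable Q" "\<And>U. open U \<Longrightarrow> U \<noteq> {} \<Longrightarrow> \<exists>a\<in>Q. a \<in> U"
    using countable_dense_exists by blast
  have comp: "(\<lambda>x. x j) \<in> borel_measurable (Pi\<^sub>M I M)" if "j \<in> I" for j
    using measurable_component_singleton[OF that, of M] assms(4)[OF that]
    by (simp cong: measurable_cong_sets)
  have "x i \<in> convex hull (x ` J) \<longleftrightarrow> (\<forall>a\<in>Q. \<exists>j\<in>J. a \<bullet> x j \<le> a \<bullet> x i)" for x :: "'i \<Rightarrow> 'a"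
    using mem_convex_hull_iff_dense[of "x ` J" Q "x i"] assms(1) Q(2) by simp
  moreover have "{x \<in> space (Pi\<^sub>M I M). \<forall>a\<in>Q. \<exists>j\<in>J. a \<bullet> x j \<le> a \<bullet> x i} \<in> sets (Pi\<^sub>M I M)"
  proof (rule sets.sets_Collect_countable_All'[OF sets.sets_Collect_finite_Ex[OF _ assms(1)] Q(1)])
    fix a j assume "j \<in> J"
    then have [measurable]: "(\<lambda>x. x i) \<in> borel_measurable (Pi\<^sub>M I M)" "(\<lambda>x. x j) \<in> borel_measurable (Pi\<^sub>M I M)"
      using assms(2,3) comp by auto
    show "{x \<in> space (Pi\<^sub>M I M). a \<bullet> x j \<le> a \<bullet> x i} \<in> sets (Pi\<^sub>M I M)"
      by measurable
  qed
  ultimately show ?thesis by (simp add: pred_def)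
qed

lemma AE_PiM_uniform_measure_mem:
  assumes "finite I" "emeasure M K \<noteq> 0" "emeasure M K \<noteq> \<infinity>"
  shows "AE x in Pi\<^sub>M I (\<lambda>_. uniform_measure M K). \<forall>i\<in>I. x i \<in> K"
proof (intro AE_finite_allI assms(1))
  fix i assume "i \<in> I"
  have "AE y in uniform_measure M K. y \<in> K"
    \<comment> \<open>A set outside \<open>sets M\<close> has measure 0 by convention, so nonzero
      measure forces \<open>K\<close> to be measurable.\<close>
    by (intro AE_uniform_measureI) (use assms(2) emeasure_notin_sets in auto)
  then show "AE x in Pi\<^sub>M I (\<lambda>_. uniform_measure M K). x i \<in> K"
    using assms \<open>i \<in> I\<close> by (intro AE_PiM_component prob_space_uniform_measure)
qed

text \<open>Fix the points indexed by \<open>J\<close> and integrate over \<open>x i\<close> first: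
  the inner integral is the share of \<open>K\<close> covered by their hull.\<close>

lemma prob_mem_convex_hull_le:
  fixes K :: "'a::euclidean_space set"
  assumes "finite J" "i \<notin> J" "compact K" "measure lborel K > 0"
    and bound: "\<And>x. x ` J \<subseteq> K \<Longrightarrow> measure lborel (convex hull (x ` J)) \<le> c"
  defines "P \<equiv> Pi\<^sub>M (insert i J) (\<lambda>_. uniform_measure lborel K)"
  shows "measure P {x \<in> space P. x i \<in> convex hull (x ` J)} \<le> c / measure lborel K"
proof -
  let ?U = "uniform_measure lborel K"
  have K: "K \<in> sets borel" "emeasure lborel K = ennreal (measure lborel K)"
    using assms(3) using emeasure_bounded_finite[of K]
    by (auto intro!: borel_compact emeasure_eq_ennreal_measure simp: compact_imp_bounded)
  then have K': "emeasure lborel K \<noteq> 0" "emeasure lborel K \<noteq> \<infinity>"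
    using assms(4) by auto
  interpret prob_space ?U using K' by (rule prob_space_uniform_measure)
  interpret product_prob_space "\<lambda>_. ?U" "insert i J" ..
  \<comment> \<open>Positive measure makes \<open>K\<close> nonempty, and a constant family in
    \<open>K\<close> shows that \<open>c\<close> bounds a nonnegative number. This is used when
    passing from \<open>ennreal\<close> back to real numbers.\<close>
  have "c \<ge> 0"
  proof -
    obtain k where "k \<in> K" using assms(4) by (cases "K = {}") auto
    then show ?thesis using bound[of "\<lambda>_. k"] by (meson image_subsetI measure_nonneg order_trans)
  qed
  have [measurable]: "Measurable.pred P (\<lambda>x. x i \<in> convex hull (x ` J))"
    unfolding P_def using assms(1) by (intro measurable_mem_convex_hull) auto
  define S where "S = {x \<in> space P. x i \<in> convex hull (x ` J)}"
  have S: "S \<in> sets P" unfolding S_def by measurable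
  have "emeasure P S = (\<integral>\<^sup>+x. indicator S x \<partial>P)"
    using S by simp
  \<comment> \<open>Tonelli's theorem splits off coordinate \<open>i\<close>.\<close>
  also have "\<dots> = (\<integral>\<^sup>+x. (\<integral>\<^sup>+y. indicator S (x(i := y)) \<partial>?U) \<partial>Pi\<^sub>M J (\<lambda>_. ?U))"
    unfolding P_def using assms(1,2) S by (intro product_nn_integral_insert) (auto simp: P_def)
  also have "\<dots> \<le> (\<integral>\<^sup>+x. ennreal (c / measure lborel K) \<partial>Pi\<^sub>M J (\<lambda>_. ?U))"
  proof (rule nn_integral_mono_AE)
    \<comment> \<open>The estimate holds only almost everywhere, because \<open>bound\<close> speaks
      of points in \<open>K\<close> while the product space contains all families.\<close>
    show "AE x in Pi\<^sub>M J (\<lambda>_. ?U). (\<integral>\<^sup>+y. indicator S (x(i := y)) \<partial>?U) \<le> ennreal (c / measure lborel K)"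
      using AE_PiM_uniform_measure_mem[OF assms(1) K']
    proof eventually_elim
      case (elim x)
      let ?H = "convex hull (x ` J)"
      have H: "compact ?H" using assms(1) by (simp add: finite_imp_compact_convex_hull)
      have HB: "?H \<in> sets borel" using H by (rule borel_compact)
      \<comment> \<open>Updating coordinate \<open>i\<close> leaves the image of \<open>J\<close>
        alone, so the hull stays fixed in the inner integral.\<close>
      have upd: "J \<inter> {k. k \<noteq> i} = J" using assms(2) by auto
      have "(\<integral>\<^sup>+y. indicator S (x(i := y)) \<partial>?U) \<le> (\<integral>\<^sup>+y. indicator ?H y \<partial>?U)"
        using assms(2) by (intro nn_integral_mono) (auto simp: S_def indicator_def upd)
      also have "\<dots> = emeasure lborel (K \<inter> ?H) / emeasure lborel K"
        using HB K by simp
      also have "\<dots> \<le> emeasure lborel ?H / emeasure lborel K"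
        using HB by (intro divide_right_mono_ennreal emeasure_mono) auto
      also have "emeasure lborel ?H = ennreal (measure lborel ?H)"
        using emeasure_bounded_finite[OF compact_imp_bounded[OF H]] by (intro emeasure_eq_ennreal_measure) auto
      also have "ennreal (measure lborel ?H) / emeasure lborel K = ennreal (measure lborel ?H / measure lborel K)"
        unfolding K(2) using assms(4) by (simp add: divide_ennreal)
      also have "\<dots> \<le> ennreal (c / measure lborel K)"
        using elim bound[of x] by (intro ennreal_leI divide_right_mono) auto
      finally show ?case .
    qed
  qed
  also have "\<dots> = ennreal (c / measure lborel K)"
    using prob_space.emeasure_space_1[OF prob_space_PiM[of J "\<lambda>_. ?U"]]
      prob_space_uniform_measure[OF K'] by simp
  finally show ?thesis
    using \<open>c \<ge> 0\<close> unfolding S_def measure_def by (intro enn2real_leI) auto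
qed

lemma prob_simplex_le:
  fixes K :: "'a::euclidean_space set"
  assumes "finite I" "Suc n < card I" "compact K" "measure lborel K > 0"
    and bound: "\<And>X. finite X \<Longrightarrow> card X < card I \<Longrightarrow> X \<subseteq> K \<Longrightarrow> measure lborel (convex hull X) \<le> c"
  defines "P \<equiv> Pi\<^sub>M I (\<lambda>_. uniform_measure lborel K)"
  shows "measure P {x \<in> space P. int n simplex (convex hull (x ` I))} \<le> real (card I) * (c / measure lborel K)"
proof -
  have K': "emeasure lborel K \<noteq> 0" "emeasure lborel K \<noteq> \<infinity>"
    using assms(3,4) emeasure_bounded_finite[of K] by (auto simp: measure_def compact_imp_bounded)
  interpret P: prob_space P
    unfolding P_def using K' by (intro prob_space_PiM prob_space_uniform_measure)
  define A where "A = (\<lambda>i. {x \<in> space P. x i \<in> convex hull (x ` (I - {i}))})"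
  have A: "A i \<in> sets P" if "i \<in> I" for i
  proof -
    have [measurable]: "Measurable.pred P (\<lambda>x. x i \<in> convex hull (x ` (I - {i})))"
      unfolding P_def using assms(1) that by (intro measurable_mem_convex_hull) auto
    show ?thesis unfolding A_def by measurable
  qed
  \<comment> \<open>Monotonicity asks for measurability of the larger set, the union of the events
    \<open>A i\<close>.\<close>
  have "measure P {x \<in> space P. int n simplex (convex hull (x ` I))} \<le> measure P (\<Union>i\<in>I. A i)"
    using simplex_convex_hull_imp_redundant_point[OF assms(1) _ assms(2)] A assms(1)
    by (intro P.finite_measure_mono) (auto simp: A_def)
  also have "\<dots> \<le> (\<Sum>i\<in>I. measure P (A i))"
    using A assms(1) by (intro P.finite_measure_subadditive_finite) auto
  also have "\<dots> \<le> (\<Sum>i\<in>I. c / measure lborel K)"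
  proof (rule sum_mono)
    fix i assume i: "i \<in> I"
    have "measure lborel (convex hull (x ` (I - {i}))) \<le> c" if "x ` (I - {i}) \<subseteq> K" for x
    proof (rule bound)
      have "card (x ` (I - {i})) \<le> card (I - {i})"
        using assms(1) by (intro card_image_le) simp
      then show "card (x ` (I - {i})) < card I"
        using card_Diff1_less[OF assms(1) i] by linarith
    qed (use that assms(1) in auto)
    \<comment> \<open>Reinserting \<open>i\<close> into \<open>I - {i}\<close> recovers
      \<open>I\<close>, so the product measure there is \<open>P\<close>.\<close>
    then show "measure P (A i) \<le> c / measure lborel K"
      using prob_mem_convex_hull_le[of "I - {i}" i K c] assms(1,3,4) i
      by (simp add: A_def P_def insert_absorb)
  qed
  finally show ?thesis by simp
qed

section \<open>Affine maps and the final estimate\<close>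

lemma affine_transformation_convex_hull:
  assumes "affine_transformation f"
  shows "f ` (convex hull X) = convex hull (f ` X)"
proof -
  obtain g c where g: "linear g" "f = (\<lambda>x. g x + c)"
    using assms unfolding affine_transformation_def by blast
  have image: "f ` Y = (+) c ` g ` Y" for Y
    by (auto simp: g(2) image_image add.commute)
  then show ?thesis
    unfolding image using g(1) by (simp only: convex_hull_linear_image convex_hull_translation)
qed

lemma bounded_affine_transformation:
  fixes f :: "'a::euclidean_space \<Rightarrow> 'b::real_normed_vector"
  assumes "affine_transformation f" "bounded K"
  shows "bounded (f ` K)"
proof -
  obtain g c where g: "linear g" "f = (\<lambda>x. g x + c)"
    using assms unfolding affine_transformation_def by blast
  have image: "f ` Y = (+) c ` g ` Y" for Y
    by (auto simp: g(2) image_image add.commute)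
  then show ?thesis
    unfolding image using g(1) assms(2)
    by (intro bounded_translation bounded_linear_image) (simp_all add: linear_conv_bounded_linear)
qed

lemma measure_convex_hull_le_diameter:
  fixes f :: "real ^ 'n \<Rightarrow> real ^ 'n"
  assumes f: "affine_transformation f" "volume_preserving f" and "bounded K"
    and X: "finite X" "card X \<le> Suc CARD('n)" "X \<subseteq> K"
  shows "measure lborel (convex hull X) \<le> diameter (f ` K) ^ CARD('n) / fact CARD('n)"
proof -
  have hull: "convex hull Y \<in> sets borel" if "finite Y" for Y :: "(real^'n) set"
    using that by (intro borel_compact finite_imp_compact_convex_hull)
  \<comment> \<open>Volume preservation is stated for \<open>lebesgue\<close>, the volume bound for
    \<open>lborel\<close>; the two agree on these compact hulls.\<close>
  have lborel: "measure lebesgue (convex hull Y) = measure lborel (convex hull Y)" if "finite Y" for Y :: "(real^'n) set"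
    using hull[OF that] by (intro measure_completion) simp
  have "convex hull X \<in> sets lebesgue"
    using hull[OF X(1)] by auto
  then have "emeasure lebesgue (convex hull X) = emeasure lebesgue (f ` (convex hull X))"
    using f(2) unfolding volume_preserving_def by metis
  then have "measure lborel (convex hull X) = measure lborel (convex hull (f ` X))"
    using lborel[of X] lborel[of "f ` X"] X(1)
    by (simp add: affine_transformation_convex_hull[OF f(1)] measure_def)
  also have "\<dots> \<le> diameter (f ` K) ^ CARD('n) / fact CARD('n)"
  proof (rule measure_convex_hull_le)
    have bounded: "bounded (f ` K)"
      using f(1) \<open>bounded K\<close> by (rule bounded_affine_transformation)
    then show "diameter (f ` K) \<ge> 0"
      by (rule diameter_ge_0)
    show "dist x y \<le> diameter (f ` K)" if "x \<in> f ` X" "y \<in> f ` X" for x y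
      using bounded that X(3) by (intro diameter_bounded_bound) auto
  qed (use X card_image_le[OF X(1), of f] in auto)
  finally show ?thesis .
qed

theorem proposition5:
  fixes \<epsilon> D :: real and d :: nat and K :: "(real ^ 'n) set"
  assumes "\<epsilon> > 0"
    and "d = CARD('n)"
    and "convex_body K"
    and "\<exists>f :: real ^ 'n \<Rightarrow> real ^ 'n.
           affine_transformation f \<and> volume_preserving f \<and> diameter (f ` K) = D"
  shows "simplex_prob K \<le> real (d + 2) * D ^ d / (fact d * measure lebesgue K) \<and>
         (D \<le> real d powr (1 - \<epsilon>) * measure lebesgue K powr (1 / real d) \<longrightarrow>
            simplex_prob K \<le> real (d + 2) * real d powr ((1 - \<epsilon>) * real d) / fact d)"
proof -
  obtain f :: "real ^ 'n \<Rightarrow> real ^ 'n"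
    where f: "affine_transformation f" "volume_preserving f" "diameter (f ` K) = D"
    using assms(4) by blast
  have K: "compact K" "convex K" "interior K \<noteq> {}"
    using assms(3) by (auto simp: convex_body_def)
  have d: "d > 0" using assms(2) by simp
  have "D \<ge> 0"
    using f(1,3) K(1) bounded_affine_transformation compact_imp_bounded diameter_ge_0 by metis
  define V where "V = measure lebesgue K"
  have V: "measure lborel K = V"
    using K(1) unfolding V_def by (intro measure_completion[symmetric]) (simp add: borel_compact)
  \<comment> \<open>A convex set is null exactly when its interior is empty.\<close>
  have "V \<noteq> 0"
    using K by (metis V_def negligible_convex_interior negligible_iff_measure0 lmeasurable_compact)
  then have "V > 0"
    by (simp add: V_def zero_less_measure_iff)
  \<comment> \<open>For \<open>I = {..<d + 2}\<close>, the condition \<open>card X < card I\<close>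
    is the bound of at most d + 1 points in the diameter estimate.\<close>
  have "simplex_prob K \<le> real (d + 2) * ((D ^ d / fact d) / V)"
    using prob_simplex_le[of "{..<d + 2}" d K "D ^ d / fact d"]
      measure_convex_hull_le_diameter[OF f(1,2) compact_imp_bounded[OF K(1)]] K(1) V \<open>V > 0\<close>
    by (simp add: simplex_prob_def uniform_points_def f(3) flip: assms(2))
  then have main: "simplex_prob K \<le> real (d + 2) * D ^ d / (fact d * V)"
    by simp
  moreover have "simplex_prob K \<le> real (d + 2) * real d powr ((1 - \<epsilon>) * real d) / fact d"
    if D: "D \<le> real d powr (1 - \<epsilon>) * V powr (1 / real d)"
  proof -
    have "D ^ d \<le> (real d powr (1 - \<epsilon>) * V powr (1 / real d)) ^ d"
      using D \<open>D \<ge> 0\<close> by (rule power_mono)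
    \<comment> \<open>Since d > 0, the d-th power of \<open>V powr (1 / real d)\<close> is
      \<open>V\<close>, which then cancels against the denominator.\<close>
    also have "\<dots> = real d powr ((1 - \<epsilon>) * real d) * V"
      using d \<open>V > 0\<close> by (simp add: power_mult_distrib powr_power mult.commute)
    finally have "real (d + 2) * D ^ d / (fact d * V)
        \<le> real (d + 2) * (real d powr ((1 - \<epsilon>) * real d) * V) / (fact d * V)"
      using \<open>V > 0\<close> by (intro divide_right_mono mult_left_mono) auto
    with main show ?thesis
      using \<open>V > 0\<close> by simp
  qed
  ultimately show ?thesis
    unfolding V_def by blast
qed

end
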